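(* Let $\mathcal{H}$ be a complex Hilbert space with $\dim \mathcal{H} \leq 4$. Then every partial isometry $T \in B(\mathcal{H})$ is complex symmetric.
   Context: $B(\mathcal{H})$ denotes the bounded linear operators on $\mathcal{H}$. A conjugation on a complex Hilbert space $\mathcal{H}$ is a conjugate-linear operator $C:\mathcal{H}\to\mathcal{H}$ which is involutive ($C^2 = I$) and isometric ($\langle Cx, Cy\rangle = \langle y, x\rangle$ for all $x,y \in \mathcal{H}$). An operator $T \in B(\mathcal{H})$ is $C$-symmetric if $T = CT^*C$, and $T$ is complex symmetric if there exists a conjugation $C$ on $\mathcal{H}$ with respect to which $T$ is $C$-symmetric. *)

theory Defs
  imports "HOL-Analysis.Analysis"
begin

class scaleC =
  fixes scaleC :: "complex \<Rightarrow> 'a \<Rightarrow> 'a" (infixr "*\<^sub>C" 75)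

text \<open>The inner product is linear in the first argument. The underlying real vector space,
  norm and topology are those of the ambient library classes.\<close>

class complex_inner = real_normed_vector + scaleC +
  fixes cinner :: "'a \<Rightarrow> 'a \<Rightarrow> complex"
  assumes scaleC_add_right: "a *\<^sub>C (x + y) = a *\<^sub>C x + a *\<^sub>C y"
    and scaleC_add_left: "(a + b) *\<^sub>C x = a *\<^sub>C x + b *\<^sub>C x"
    and scaleC_scaleC: "a *\<^sub>C b *\<^sub>C x = (a * b) *\<^sub>C x"
    and scaleR_scaleC: "r *\<^sub>R x = complex_of_real r *\<^sub>C x"
    and cinner_commute: "cinner x y = cnj (cinner y x)"
    and cinner_add_left: "cinner (x + y) z = cinner x z + cinner y z"
    and cinner_scaleC_left: "cinner (a *\<^sub>C x) y = a * cinner x y"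
    and cinner_self_nonneg: "0 \<le> Re (cinner x x)"
    and cinner_self_eq_zero_iff: "cinner x x = 0 \<longleftrightarrow> x = 0"
    and norm_eq_sqrt_cinner: "norm x = sqrt (Re (cinner x x))"

class chilbert_space = complex_inner + complete_space

lemma vector_space_scaleC: "vector_space (scaleC :: complex \<Rightarrow> 'a \<Rightarrow> 'a::complex_inner)"
proof
  fix x :: 'a
  show "1 *\<^sub>C x = x"
    using scaleR_scaleC[of 1 x] by simp
qed (simp_all add: scaleC_add_right scaleC_add_left scaleC_scaleC)

global_interpretation complex_vector:
  vector_space "scaleC :: complex \<Rightarrow> 'a \<Rightarrow> 'a::complex_inner"
  by (rule vector_space_scaleC)

definition bounded_clinear :: "('a::complex_inner \<Rightarrow> 'a) \<Rightarrow> bool" where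
  "bounded_clinear T \<longleftrightarrow> bounded_linear T \<and> (\<forall>a x. T (a *\<^sub>C x) = a *\<^sub>C T x)"

text \<open>Only meaningful when an adjoint exists, as it does for every bounded operator on a
  Hilbert space; uniqueness holds by nondegeneracy of the inner product.\<close>

definition cadjoint :: "('a::complex_inner \<Rightarrow> 'a) \<Rightarrow> 'a \<Rightarrow> 'a" where
  "cadjoint T = (THE S. \<forall>x y. cinner (T x) y = cinner x (S y))"

lemma cadjoint_eqI:
  fixes T S :: "'a::complex_inner \<Rightarrow> 'a"
  assumes S: "\<And>x y. cinner (T x) y = cinner x (S y)"
  shows "cadjoint T = S"
  unfolding cadjoint_def
proof (rule the_equality)
  show "\<forall>x y. cinner (T x) y = cinner x (S y)"
    using S by blast
next
  fix R assume R: "\<forall>x y. cinner (T x) y = cinner x (R y)"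
  show "R = S"
  proof
    fix y
    have eq: "cinner (R y) x = cinner (S y) x" for x
      using R S cinner_commute by metis
    have "cinner (R y - S y) x + cinner (S y) x = cinner (S y) x" for x
      using cinner_add_left[of "R y - S y" "S y" x] eq[of x] by simp
    then have "cinner (R y - S y) (R y - S y) = 0"
      by simp
    then show "R y = S y"
      by (simp add: cinner_self_eq_zero_iff)
  qed
qed

definition corthogonal_comp :: "'a::complex_inner set \<Rightarrow> 'a set" where
  "corthogonal_comp M = {x. \<forall>y\<in>M. cinner x y = 0}"

definition partial_isometry :: "('a::complex_inner \<Rightarrow> 'a) \<Rightarrow> bool" where
  "partial_isometry T \<longleftrightarrow> (\<forall>x \<in> corthogonal_comp {y. T y = 0}. norm (T x) = norm x)"

definition conjugation :: "('a::complex_inner \<Rightarrow> 'a) \<Rightarrow> bool" where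
  "conjugation C \<longleftrightarrow>
     (\<forall>x y. C (x + y) = C x + C y) \<and> (\<forall>a x. C (a *\<^sub>C x) = cnj a *\<^sub>C C x) \<and>
     (\<forall>x. C (C x) = x) \<and> (\<forall>x y. cinner (C x) (C y) = cinner y x)"

definition symmetric_wrt :: "('a::complex_inner \<Rightarrow> 'a) \<Rightarrow> ('a \<Rightarrow> 'a) \<Rightarrow> bool" where
  "symmetric_wrt C T \<longleftrightarrow> T = C \<circ> cadjoint T \<circ> C"

definition complex_symmetric :: "('a::complex_inner \<Rightarrow> 'a) \<Rightarrow> bool" where
  "complex_symmetric T \<longleftrightarrow> (\<exists>C. conjugation C \<and> symmetric_wrt C T)"

end

theory Submission
  imports Defs "HOL-Computational_Algebra.Fundamental_Theorem_Algebra"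
begin

text \<open>Write \<open>K\<close> for the kernel of the partial isometry \<open>T\<close> and \<open>M\<close> for its orthogonal
  complement, on which \<open>T\<close> preserves inner products. The proof has three ingredients.

  First, it is enough to find an orthonormal basis \<open>u\<^sub>1, \<dots>, u\<^sub>r\<close> of \<open>M\<close> in which the compression of
  \<open>T\<close> to \<open>M\<close> has a symmetric matrix, \<open>\<langle>T u\<^sub>i, u\<^sub>j\<rangle> = \<langle>T u\<^sub>j, u\<^sub>i\<rangle>\<close>
  (\<open>complex_symmetric_of_symmetric_matrix\<close>). Symmetry together with isometry says exactly that the
  vectors \<open>u\<^sub>i + T u\<^sub>i\<close> and \<open>\<i> (u\<^sub>i - T u\<^sub>i)\<close> have real inner products with one another. Vectors
  with real inner products are simultaneously fixed by a conjugation \<open>C\<close>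
  (\<open>conjugation_fixing\<close>), and fixing these vectors means exchanging \<open>u\<^sub>i\<close> and \<open>T u\<^sub>i\<close>.
  Such a \<open>C\<close> makes \<open>T\<close> symmetric.

  Second, if \<open>dim M \<le> 2\<close>, such a basis exists because every complex matrix of size at most two is
  unitarily equivalent to a symmetric one (\<open>symmetric_matrix_of_card_le_2\<close>).

  Third, if \<open>dim K \<le> 1\<close>, extend the restriction of \<open>T\<close> to \<open>M\<close> to a unitary \<open>U\<close>
  (\<open>unitary_extension\<close>) and choose an orthonormal basis of eigenvectors of \<open>U\<close>, with phases such
  that a vector spanning \<open>K\<close> has real coefficients. The vectors with real coefficients form a real
  subspace on which \<open>\<langle>U x, y\<rangle>\<close> is symmetric, and an orthonormal basis of this real subspace can be
  chosen to contain a unit vector of \<open>K\<close> when there is one; its other members form the required basis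
  of \<open>M\<close> (\<open>unitary_symmetric_matrix\<close>).

  As \<open>dim M + dim K \<le> 4\<close>, one of the last two cases applies. Finiteness of the dimension enters
  as a finite spanning set \<open>B\<close>.\<close>

section \<open>Linear maps and inner products\<close>

abbreviation clinear :: "('a::complex_inner \<Rightarrow> 'a) \<Rightarrow> bool" where
  "clinear \<equiv> Vector_Spaces.linear scaleC scaleC"

lemma clinear_add: "clinear T \<Longrightarrow> T (x + y) = T x + T y"
  by (rule module_hom.add) (rule Vector_Spaces.linear.axioms)

lemma clinear_scaleC: "clinear T \<Longrightarrow> T (a *\<^sub>C x) = a *\<^sub>C T x"
  by (rule module_hom.scale) (rule Vector_Spaces.linear.axioms)

lemma clinear_zero: "clinear T \<Longrightarrow> T 0 = 0"
  by (rule module_hom.zero) (rule Vector_Spaces.linear.axioms)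

lemma clinear_diff: "clinear T \<Longrightarrow> T (x - y) = T x - T y"
  by (rule module_hom.diff) (rule Vector_Spaces.linear.axioms)

lemma clinear_sum: "clinear T \<Longrightarrow> T (\<Sum>i\<in>I. f i) = (\<Sum>i\<in>I. T (f i))"
  by (rule module_hom.sum) (rule Vector_Spaces.linear.axioms)

lemma clinearI:
  fixes T :: "'a::complex_inner \<Rightarrow> 'a"
  assumes "\<And>x y. T (x + y) = T x + T y" and "\<And>a x. T (a *\<^sub>C x) = a *\<^sub>C T x"
  shows "clinear T"
  by unfold_locales (use assms in auto)

lemmas clinear_simps = clinear_add clinear_scaleC clinear_zero clinear_diff clinear_sum

lemma cinner_zero_left [simp]: "cinner 0 (y::'a::complex_inner) = 0"
  using cinner_add_left[of 0 0 y] by simp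

lemma cinner_zero_right [simp]: "cinner (y::'a::complex_inner) 0 = 0"
  using cinner_commute[of y 0] by simp

lemma cinner_add_right: "cinner (z::'a::complex_inner) (x + y) = cinner z x + cinner z y"
  by (subst (1 2 3) cinner_commute) (simp add: cinner_add_left)

lemma cinner_scaleC_right: "cinner (x::'a::complex_inner) (a *\<^sub>C y) = cnj a * cinner x y"
  by (subst (1 2) cinner_commute) (simp add: cinner_scaleC_left)

lemma cinner_diff_left: "cinner (x - y) (z::'a::complex_inner) = cinner x z - cinner y z"
  using cinner_add_left[of "x - y" y z] by simp

lemma cinner_diff_right: "cinner (z::'a::complex_inner) (x - y) = cinner z x - cinner z y"
  using cinner_add_right[of z "x - y" y] by simp

lemma cinner_sum_left: "cinner (\<Sum>i\<in>I. f i) (z::'a::complex_inner) = (\<Sum>i\<in>I. cinner (f i) z)"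
  by (induction I rule: infinite_finite_induct) (auto simp: cinner_add_left)

lemma cinner_sum_right: "cinner (z::'a::complex_inner) (\<Sum>i\<in>I. f i) = (\<Sum>i\<in>I. cinner z (f i))"
  by (induction I rule: infinite_finite_induct) (auto simp: cinner_add_right)

lemmas cinner_simps = cinner_add_left cinner_add_right cinner_diff_left cinner_diff_right
  cinner_scaleC_left cinner_scaleC_right
  cinner_sum_left cinner_sum_right

lemma cinner_self: "cinner x x = complex_of_real ((norm (x::'a::complex_inner))\<^sup>2)"
proof -
  have "Im (cinner x x) = 0"
    using cinner_commute[of x x] by (simp add: complex_eq_iff)
  then show ?thesis
    by (simp add: complex_eq_iff norm_eq_sqrt_cinner cinner_self_nonneg)
qed

lemma cinner_real_commute:
  "cinner (x::'a::complex_inner) y \<in> \<real> \<Longrightarrow> cinner y x = cinner x y"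
  by (metis Reals_cnj_iff cinner_commute)

section \<open>Orthonormal sets\<close>

definition orthonormal :: "'a::complex_inner set \<Rightarrow> bool" where
  "orthonormal E \<longleftrightarrow> (\<forall>e\<in>E. \<forall>f\<in>E. cinner e f = (if e = f then 1 else 0))"

definition expansion :: "'a::complex_inner set \<Rightarrow> 'a \<Rightarrow> 'a" where
  "expansion E x = (\<Sum>e\<in>E. cinner x e *\<^sub>C e)"

definition orthonormal_basis :: "'a::complex_inner set \<Rightarrow> bool" where
  "orthonormal_basis E \<longleftrightarrow> finite E \<and> orthonormal E \<and> (\<forall>x. expansion E x = x)"

lemma orthonormalD:
  "orthonormal E \<Longrightarrow> e \<in> E \<Longrightarrow> f \<in> E \<Longrightarrow> cinner e f = (if e = f then 1 else 0)"
  by (auto simp: orthonormal_def)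

lemma orthonormal_subset: "orthonormal E \<Longrightarrow> F \<subseteq> E \<Longrightarrow> orthonormal F"
  unfolding orthonormal_def by blast

lemma cinner_expansion_left: "cinner (expansion E x) y = (\<Sum>e\<in>E. cinner x e * cinner e y)"
  by (simp add: expansion_def cinner_simps)

lemma cinner_expansion_right: "cinner y (expansion E x) = (\<Sum>e\<in>E. cinner y e * cnj (cinner x e))"
  by (simp add: expansion_def cinner_simps mult.commute)

lemma cinner_orthonormal_sum:
  assumes "orthonormal E" "finite E" "e \<in> E"
  shows "cinner (\<Sum>f\<in>E. c f *\<^sub>C f) e = c e"
proof -
  have "cinner (\<Sum>f\<in>E. c f *\<^sub>C f) e = (\<Sum>f\<in>E. if f = e then c f else 0)"
    unfolding cinner_sum_left
    by (rule sum.cong) (use assms in \<open>auto simp: cinner_scaleC_left orthonormalD\<close>)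
  then show ?thesis
    using assms by simp
qed

lemma cinner_expansion_orthonormal:
  assumes "orthonormal E" "finite E" "e \<in> E"
  shows "cinner (expansion E x) e = cinner x e"
  unfolding expansion_def by (rule cinner_orthonormal_sum[OF assms])

lemma expansion_split:
  assumes "finite E" "D \<subseteq> E"
  shows "expansion E x = expansion (E - D) x + expansion D x"
  unfolding expansion_def by (rule sum.subset_diff[OF assms(2,1)])

lemma parseval:
  assumes "orthonormal_basis E"
  shows "cinner x y = (\<Sum>e\<in>E. cinner x e * cinner e y)"
  using assms cinner_expansion_left[of E x y] by (simp add: orthonormal_basis_def)

lemma parseval_coefficients:
  assumes "orthonormal_basis E"
  shows "cinner x y = (\<Sum>e\<in>E. cinner x e * cnj (cinner y e))"
  using assms cinner_expansion_right[of x E y] by (simp add: orthonormal_basis_def)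

lemma orthonormal_independent:
  assumes "orthonormal E"
  shows "complex_vector.independent E"
proof
  assume "complex_vector.dependent E"
  then obtain t u v where t: "finite t" "t \<subseteq> E" "(\<Sum>w\<in>t. u w *\<^sub>C w) = 0" "v \<in> t" "u v \<noteq> 0"
    unfolding complex_vector.dependent_explicit by blast
  have "cinner (\<Sum>w\<in>t. u w *\<^sub>C w) v = u v"
    by (rule cinner_orthonormal_sum) (use t assms orthonormal_subset in auto)
  with t show False
    by simp
qed

lemma orthonormal_basis_span:
  assumes "orthonormal_basis E"
  shows "complex_vector.span E = UNIV"
proof -
  have "expansion E x \<in> complex_vector.span E" for x
    unfolding expansion_def
    by (intro complex_vector.span_sum complex_vector.span_scale complex_vector.span_base)
  with assms show ?thesis
    by (auto simp: orthonormal_basis_def)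
qed

lemma orthonormal_card_le:
  fixes E B :: "'a::complex_inner set"
  assumes "orthonormal E" "finite B" "complex_vector.span B = UNIV"
  shows "finite E \<and> card E \<le> card B"
  using complex_vector.independent_span_bound[OF assms(2) orthonormal_independent[OF assms(1)]] assms(3)
  by simp

lemma orthonormal_basis_card_eq:
  fixes E F :: "'a::complex_inner set"
  assumes "orthonormal_basis E" "orthonormal_basis F"
  shows "card E = card F"
  using assms orthonormal_card_le[of E F] orthonormal_card_le[of F E] orthonormal_basis_span
  by (fastforce simp: orthonormal_basis_def)

text \<open>All orthonormal systems below are built by extending within a prescribed set \<open>Q\<close> as far as
  possible; cardinalities are bounded by the dimension. The point of stating this for an arbitrary
  \<open>Q\<close> is that it serves for complex subspaces, for real subspaces and for sets of eigenvectors.\<close>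

lemma maximal_orthonormal:
  fixes E0 :: "'a::complex_inner set"
  assumes B: "finite B" "complex_vector.span B = (UNIV :: 'a set)"
    and E0: "orthonormal E0" "E0 \<subseteq> Q"
  obtains E where "finite E" "orthonormal E" "E0 \<subseteq> E" "E \<subseteq> Q"
    and "\<And>x. x \<in> Q \<Longrightarrow> norm x = 1 \<Longrightarrow> \<exists>e\<in>E. cinner x e \<noteq> 0"
proof -
  let ?P = "\<lambda>E. orthonormal E \<and> E0 \<subseteq> E \<and> E \<subseteq> Q"
  have "\<exists>E. ?P E \<and> (\<forall>E'. ?P E' \<longrightarrow> card E' \<le> card E)"
  proof (rule ex_has_greatest_nat)
    show "?P E0"
      using E0 by simp
    show "\<forall>E. ?P E \<longrightarrow> card E < Suc (card B)"
      using orthonormal_card_le[OF _ B] by (auto simp: less_Suc_eq_le)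
  qed
  then obtain E where E: "?P E" and max: "\<And>E'. ?P E' \<Longrightarrow> card E' \<le> card E"
    by blast
  have fin: "finite E"
    using orthonormal_card_le[OF _ B] E by blast
  show ?thesis
  proof (rule that)
    fix x assume x: "x \<in> Q" "norm x = 1"
    show "\<exists>e\<in>E. cinner x e \<noteq> 0"
    proof (rule ccontr)
      assume "\<not> ?thesis"
      then have orth: "\<And>e. e \<in> E \<Longrightarrow> cinner x e = 0"
        by blast
      then have orth': "\<And>e. e \<in> E \<Longrightarrow> cinner e x = 0"
        using cinner_commute by (metis complex_cnj_zero)
      have xx: "cinner x x = 1"
        using x by (simp add: cinner_self)
      then have "x \<notin> E"
        using orth by force
      have "?P (insert x E)"
        using E x orth orth' xx \<open>x \<notin> E\<close> by (auto simp: orthonormal_def)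
      from max[OF this] show False
        using fin \<open>x \<notin> E\<close> by simp
    qed
  qed (use E fin in auto)
qed

text \<open>Gram-Schmidt for a real subspace \<open>V\<close>. The closure condition keeps \<open>x - expansion E x\<close>
  inside \<open>V\<close>. It holds for complex subspaces, and for real subspaces on which the inner product is
  real-valued; in the latter case the expansions have real coefficients.\<close>

lemma orthonormal_extend:
  fixes V :: "'a::complex_inner set"
  assumes B: "finite B" "complex_vector.span B = (UNIV :: 'a set)"
    and V: "subspace V" "\<And>x y. x \<in> V \<Longrightarrow> y \<in> V \<Longrightarrow> cinner x y *\<^sub>C y \<in> V"
    and E0: "orthonormal E0" "E0 \<subseteq> V"
  obtains E where "finite E" "orthonormal E" "E0 \<subseteq> E" "E \<subseteq> V"
    and "\<And>x. x \<in> V \<Longrightarrow> expansion E x = x"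
proof (rule maximal_orthonormal[OF B E0])
  fix E assume E: "finite E" "orthonormal E" "E0 \<subseteq> E" "E \<subseteq> V"
    and max: "\<And>x. x \<in> V \<Longrightarrow> norm x = 1 \<Longrightarrow> \<exists>e\<in>E. cinner x e \<noteq> 0"
  have "expansion E x = x" if "x \<in> V" for x
  proof (rule ccontr)
    assume ne: "expansion E x \<noteq> x"
    define y where "y = x - expansion E x"
    have "y \<in> V"
      unfolding y_def expansion_def
      by (intro subspace_diff subspace_sum V that) (use E in auto)
    then have "(1 / norm y) *\<^sub>R y \<in> V"
      using V(1) by (rule subspace_scale[rotated])
    moreover have "norm ((1 / norm y) *\<^sub>R y) = 1"
      using ne by (simp add: y_def)
    moreover have "cinner ((1 / norm y) *\<^sub>R y) e = 0" if "e \<in> E" for e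
      using cinner_expansion_orthonormal[OF E(2,1) that, of x]
      by (simp add: scaleR_scaleC y_def cinner_simps)
    ultimately show False
      using max by blast
  qed
  with E show ?thesis
    by (rule that)
qed

lemma complex_subspace_imp_subspace:
  fixes V :: "'a::complex_inner set"
  shows "complex_vector.subspace V \<Longrightarrow> subspace V"
  by (auto simp: complex_vector.subspace_def subspace_def scaleR_scaleC)

lemma orthonormal_basis_extend:
  fixes E0 :: "'a::complex_inner set"
  assumes B: "finite B" "complex_vector.span B = (UNIV :: 'a set)"
    and E0: "orthonormal E0"
  obtains E where "orthonormal_basis E" "E0 \<subseteq> E"
proof (rule orthonormal_extend[OF B, of UNIV E0])
  fix E assume "finite E" "orthonormal E" "E0 \<subseteq> E" "\<And>x::'a. x \<in> UNIV \<Longrightarrow> expansion E x = x"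
  then show ?thesis
    by (intro that) (auto simp: orthonormal_basis_def)
qed (use E0 in auto)

section \<open>Conjugations and real inner products\<close>

lemma conjugation_of_basis:
  assumes E: "orthonormal_basis E"
  shows "conjugation (\<lambda>x. \<Sum>e\<in>E. cnj (cinner x e) *\<^sub>C e)" (is "conjugation ?C")
proof -
  have coeff: "cinner (?C x) e = cnj (cinner x e)" if "e \<in> E" for x e
    by (rule cinner_orthonormal_sum) (use that E in \<open>auto simp: orthonormal_basis_def\<close>)
  have "?C (?C x) = x" for x
  proof -
    have "?C (?C x) = expansion E x"
      unfolding expansion_def by (rule sum.cong) (simp_all add: coeff)
    then show ?thesis
      using E by (simp add: orthonormal_basis_def)
  qed
  moreover have "cinner (?C x) (?C y) = cinner y x" for x y
  proof -
    have "cinner (?C x) (?C y) = (\<Sum>e\<in>E. cinner (?C x) e * cnj (cinner (?C y) e))"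
      by (rule parseval_coefficients[OF E])
    also have "\<dots> = (\<Sum>e\<in>E. cinner y e * cnj (cinner x e))"
      by (rule sum.cong) (simp_all add: coeff)
    finally show ?thesis
      by (simp add: parseval_coefficients[OF E, of y x])
  qed
  ultimately show ?thesis
    unfolding conjugation_def
    by (simp add: cinner_simps complex_vector.scale_left_distrib sum.distrib
        complex_vector.scale_sum_right)
qed

text \<open>The real span of \<open>F\<close> inherits real inner products, so Gram-Schmidt inside it yields an
  orthonormal set \<open>E1\<close> in which the members of \<open>F\<close> have real coefficients. Any extension of \<open>E1\<close> to
  an orthonormal basis of the whole space only adds zero coefficients.\<close>

lemma conjugation_fixing:
  fixes F :: "'a::complex_inner set"
  assumes B: "finite B" "complex_vector.span B = (UNIV :: 'a set)"
    and F: "\<And>x y. x \<in> F \<Longrightarrow> y \<in> F \<Longrightarrow> cinner x y \<in> \<real>"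
  obtains C where "conjugation C" "\<And>x. x \<in> F \<Longrightarrow> C x = x"
proof -
  have half: "cinner x y \<in> \<real>" if "x \<in> span F" "y \<in> F" for x y
    using that(1)
  proof (induction rule: span_induct_alt)
    case (step c z w)
    then show ?case
      using F that(2) by (simp add: cinner_simps scaleR_scaleC)
  qed simp
  have real: "cinner x y \<in> \<real>" if "x \<in> span F" "y \<in> span F" for x y
    using that(2)
  proof (induction rule: span_induct_alt)
    case (step c z w)
    then show ?case
      using half[OF that(1)] by (simp add: cinner_simps scaleR_scaleC)
  qed simp
  have "cinner x y *\<^sub>C y \<in> span F" if "x \<in> span F" "y \<in> span F" for x y
    using real[OF that] that(2) by (auto elim!: Reals_cases simp flip: scaleR_scaleC intro: span_scale)
  then obtain E1 where E1: "finite E1" "orthonormal E1" "E1 \<subseteq> span F"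
    "\<And>x. x \<in> span F \<Longrightarrow> expansion E1 x = x"
    using orthonormal_extend[OF B subspace_span[of F], of "{}"] by (auto simp: orthonormal_def)
  obtain E where E: "orthonormal_basis E" "E1 \<subseteq> E"
    using orthonormal_basis_extend[OF B E1(2)] by blast
  have coeff: "cinner x e \<in> \<real>" if "x \<in> F" "e \<in> E" for x e
  proof (cases "e \<in> E1")
    case True
    then show ?thesis
      using real[of x e] E1(3) span_base[OF that(1)] by blast
  next
    case False
    have "cinner x e = cinner (expansion E1 x) e"
      using E1(4)[OF span_base[OF that(1)]] by simp
    also have "\<dots> = 0"
    proof -
      have "cinner f e = 0" if "f \<in> E1" for f
        using E \<open>e \<in> E\<close> False that orthonormalD[of E f e] by (auto simp: orthonormal_basis_def)
      then show ?thesis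
        by (simp add: cinner_expansion_left)
    qed
    finally show ?thesis
      by simp
  qed
  show ?thesis
  proof (rule that[OF conjugation_of_basis[OF E(1)]])
    fix x assume "x \<in> F"
    then have "(\<Sum>e\<in>E. cnj (cinner x e) *\<^sub>C e) = expansion E x"
      unfolding expansion_def by (intro sum.cong) (auto simp: coeff Reals_cnj_iff[THEN iffD1])
    then show "(\<Sum>e\<in>E. cnj (cinner x e) *\<^sub>C e) = x"
      using E by (simp add: orthonormal_basis_def)
  qed
qed

section \<open>A criterion for complex symmetry\<close>

text \<open>The hypothesis is symmetry of the bilinear form \<open>(x, z) \<mapsto> \<langle>T x, C z\<rangle>\<close>. Substituting
  \<open>z = C y\<close> turns it into the statement that \<open>C T C\<close> is the adjoint of \<open>T\<close>.\<close>

lemma complex_symmetricI: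
  fixes T :: "'a::complex_inner \<Rightarrow> 'a"
  assumes C: "conjugation C" and sym: "\<And>x z. cinner (T x) (C z) = cinner (T z) (C x)"
  shows "complex_symmetric T"
proof -
  have CC: "C (C x) = x" and CI: "cinner (C x) (C y) = cinner y x" for x y
    using C by (auto simp: conjugation_def)
  have "cadjoint T = C \<circ> T \<circ> C"
  proof (rule cadjoint_eqI)
    fix x y
    have "cinner (T x) y = cinner (T (C y)) (C x)"
      using sym[of x "C y"] by (simp add: CC)
    also have "\<dots> = cinner x (C (T (C y)))"
      using CI[of "C x" "T (C y)"] by (simp add: CC)
    finally show "cinner (T x) y = cinner x ((C \<circ> T \<circ> C) y)"
      by simp
  qed
  then have "symmetric_wrt C T"
    by (auto simp: symmetric_wrt_def CC)
  with C show ?thesis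
    unfolding complex_symmetric_def by blast
qed

text \<open>Here \<open>E\<close> is an orthonormal basis of a complement of the kernel, as expressed by
  \<open>T (expansion E x) = T x\<close>. The fixed vectors prescribed for \<open>C\<close> encode \<open>C u = T u\<close> for \<open>u\<close>
  in \<open>E\<close>: by antilinearity \<open>C\<close> fixes \<open>u + T u\<close> and \<open>\<i> (u - T u)\<close> precisely when it exchanges \<open>u\<close>
  and \<open>T u\<close>. Then \<open>\<langle>T x, C z\<rangle>\<close> is the sum of \<open>\<langle>x, u\<rangle> \<langle>z, u\<rangle>\<close> over \<open>u\<close> in \<open>E\<close>, which is symmetric in
  \<open>x\<close> and \<open>z\<close>.\<close>

lemma complex_symmetric_of_symmetric_matrix:
  fixes T :: "'a::complex_inner \<Rightarrow> 'a"
  assumes B: "finite B" "complex_vector.span B = (UNIV :: 'a set)"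
    and T: "clinear T"
    and E: "orthonormal E" "\<And>x. T (expansion E x) = T x"
    and iso: "\<And>u v. u \<in> E \<Longrightarrow> v \<in> E \<Longrightarrow> cinner (T u) (T v) = cinner u v"
    and sym: "\<And>u v. u \<in> E \<Longrightarrow> v \<in> E \<Longrightarrow> cinner (T u) v = cinner (T v) u"
  shows "complex_symmetric T"
proof -
  define F where "F = (\<lambda>u. u + T u) ` E \<union> (\<lambda>u. \<i> *\<^sub>C (u - T u)) ` E"
  have real: "cinner u v \<in> \<real>" if "u \<in> E" "v \<in> E" for u v
    using E(1) that by (simp add: orthonormal_def)
  have sym': "cinner u (T v) = cnj (cinner (T u) v)" if "u \<in> E" "v \<in> E" for u v
    using sym[OF that] cinner_commute[of u "T v"] by simp
  have "cinner x y \<in> \<real>" if xy: "x \<in> F" "y \<in> F" for x y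
    using xy real unfolding F_def
    by (auto simp: cinner_simps iso sym' complex_is_Real_iff algebra_simps)
  then obtain C where C: "conjugation C" and fixed: "\<And>x. x \<in> F \<Longrightarrow> C x = x"
    using conjugation_fixing[OF B, of F] by blast
  have Cadd: "C (x + y) = C x + C y" and Cscale: "C (a *\<^sub>C x) = cnj a *\<^sub>C C x"
    and CI: "cinner (C x) (C y) = cinner y x" for x y a
    using C by (auto simp: conjugation_def)
  \<comment> \<open>Recover \<open>2 u\<close> from the two fixed vectors attached to \<open>u\<close>.\<close>
  have CT: "C u = T u" if "u \<in> E" for u
  proof -
    have "u + u = (u + T u) + (- \<i>) *\<^sub>C (\<i> *\<^sub>C (u - T u))"
      by simp
    then have "C (u + u) = C (u + T u) + \<i> *\<^sub>C C (\<i> *\<^sub>C (u - T u))"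
      by (metis Cadd Cscale complex_cnj_i complex_cnj_minus minus_minus)
    also have "\<dots> = T u + T u"
      using that fixed by (simp add: F_def)
    finally have "2 *\<^sub>R C u = 2 *\<^sub>R T u"
      unfolding Cadd by (simp add: scaleR_2)
    then show ?thesis
      by simp
  qed
  have C0: "C 0 = 0"
    using Cadd[of 0 0] by simp
  have Csum: "C (\<Sum>u\<in>I. f u) = (\<Sum>u\<in>I. C (f u))" for f and I :: "'a set"
    by (induction I rule: infinite_finite_induct) (auto simp: C0 Cadd)
  have form: "cinner (T x) (C z) = (\<Sum>u\<in>E. cinner x u * cinner z u)" for x z
  proof -
    have "T x = (\<Sum>u\<in>E. cinner x u *\<^sub>C T u)"
      unfolding E(2)[symmetric, of x] expansion_def by (simp add: clinear_simps[OF T])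
    also have "\<dots> = C (\<Sum>u\<in>E. cnj (cinner x u) *\<^sub>C u)"
      by (simp add: Csum Cscale CT)
    finally have "cinner (T x) (C z) = cinner z (\<Sum>u\<in>E. cnj (cinner x u) *\<^sub>C u)"
      by (simp add: CI)
    then show ?thesis
      by (simp add: cinner_simps)
  qed
  show ?thesis
    by (rule complex_symmetricI[OF C]) (simp add: form mult.commute)
qed

section \<open>Matrices of size two\<close>

lemma rotate_orthonormal_pair:
  fixes e1 e2 :: "'a::complex_inner" and \<alpha> \<beta> :: complex
  assumes e: "orthonormal {e1, e2}" "e1 \<noteq> e2" and ab: "\<alpha> * cnj \<alpha> + \<beta> * cnj \<beta> = 1"
  defines "f1 \<equiv> \<alpha> *\<^sub>C e1 + \<beta> *\<^sub>C e2" and "f2 \<equiv> cnj \<alpha> *\<^sub>C e2 - cnj \<beta> *\<^sub>C e1"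
  shows "orthonormal {f1, f2}" "f1 \<noteq> f2" "expansion {f1, f2} = expansion {e1, e2}"
proof -
  have E: "cinner e1 e1 = 1" "cinner e2 e2 = 1" "cinner e1 e2 = 0" "cinner e2 e1 = 0"
    using e by (auto simp: orthonormal_def)
  have F: "cinner f1 f1 = 1" "cinner f2 f2 = 1" "cinner f1 f2 = 0" "cinner f2 f1 = 0"
    using ab by (simp_all add: f1_def f2_def cinner_simps E algebra_simps)
  then show ne: "f1 \<noteq> f2"
    by force
  with F show "orthonormal {f1, f2}"
    by (auto simp: orthonormal_def)
  show "expansion {f1, f2} = expansion {e1, e2}"
  proof
    fix x
    have 1: "cinner x f1 * \<alpha> - cinner x f2 * cnj \<beta> = cinner x e1"
    proof -
      have "cinner x f1 * \<alpha> - cinner x f2 * cnj \<beta> = (\<alpha> * cnj \<alpha> + \<beta> * cnj \<beta>) * cinner x e1"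
        by (simp add: f1_def f2_def cinner_simps algebra_simps)
      then show ?thesis by (simp add: ab)
    qed
    have 2: "cinner x f1 * \<beta> + cinner x f2 * cnj \<alpha> = cinner x e2"
    proof -
      have "cinner x f1 * \<beta> + cinner x f2 * cnj \<alpha> = (\<alpha> * cnj \<alpha> + \<beta> * cnj \<beta>) * cinner x e2"
        by (simp add: f1_def f2_def cinner_simps algebra_simps)
      then show ?thesis by (simp add: ab)
    qed
    have "cinner x f1 *\<^sub>C f1 + cinner x f2 *\<^sub>C f2
        = (cinner x f1 * \<alpha> - cinner x f2 * cnj \<beta>) *\<^sub>C e1
          + (cinner x f1 * \<beta> + cinner x f2 * cnj \<alpha>) *\<^sub>C e2"
      unfolding f1_def f2_def
      by (simp add: complex_vector.scale_left_distrib complex_vector.scale_right_distrib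
          complex_vector.scale_left_diff_distrib complex_vector.scale_right_diff_distrib)
    then show "expansion {f1, f2} x = expansion {e1, e2} x"
      using e(2) ne by (simp add: expansion_def 1 2)
  qed
qed

text \<open>Three vectors of the real plane are linearly dependent. If \<open>p\<close> and \<open>q\<close> are independent,
  Cramer's rule gives the coefficients as oriented areas; otherwise \<open>p\<close> and \<open>q\<close> alone are
  dependent.\<close>

lemma real_unit_relation:
  fixes p q d :: complex
  obtains k l m :: real where "k\<^sup>2 + l\<^sup>2 + m\<^sup>2 = 1" "k * p + l * q + m * d = 0"
proof -
  have "\<exists>(k::real) (l::real) (m::real). (k\<^sup>2 + l\<^sup>2 + m\<^sup>2 :: real) \<noteq> 0 \<and> k * p + l * q + m * d = 0"
  proof (cases "Im (p * cnj q) = 0")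
    case False
    let ?k = "Im (q * cnj d)" and ?l = "Im (d * cnj p)" and ?m = "Im (p * cnj q)"
    have "?k * p + ?l * q + ?m * d = 0"
      by (simp add: complex_eq_iff algebra_simps)
    moreover have "?k\<^sup>2 + ?l\<^sup>2 + ?m\<^sup>2 \<noteq> 0"
      using False by (smt (verit) zero_le_power2 zero_less_power2)
    ultimately show ?thesis
      by blast
  next
    case True
    show ?thesis
    proof (cases "p = 0")
      case True
      then show ?thesis
        by (intro exI[of _ 1] exI[of _ 0]) simp
    next
      case False
      let ?n = "(Re p)\<^sup>2 + (Im p)\<^sup>2"
      have "Im p * Re q = Im q * Re p"
        using True by simp
      then have "Re (q * cnj p) * Re p = ?n * Re q" "Re (q * cnj p) * Im p = ?n * Im q"
        by (simp, algebra)+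
      then have "Re (q * cnj p) * p + (- ?n) * q + 0 * d = 0"
        by (simp add: complex_eq_iff algebra_simps)
      moreover have "?n \<noteq> 0"
        using False by (simp add: complex_eq_iff sum_power2_eq_zero_iff)
      then have "(Re (q * cnj p))\<^sup>2 + (- ?n)\<^sup>2 + 0\<^sup>2 \<noteq> 0"
        by (smt (verit) zero_le_power2 zero_eq_power2 power2_minus)
      ultimately show ?thesis
        by (intro exI[of _ "Re (q * cnj p)"] exI[of _ "- ?n"] exI[of _ 0]) simp
    qed
  qed
  then obtain k l m :: real where *: "k\<^sup>2 + l\<^sup>2 + m\<^sup>2 \<noteq> 0" "k * p + l * q + m * d = 0"
    by blast
  define s where "s = sqrt (k\<^sup>2 + l\<^sup>2 + m\<^sup>2)"
  have s: "s\<^sup>2 = k\<^sup>2 + l\<^sup>2 + m\<^sup>2" "s \<noteq> 0"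
    using * by (auto simp: s_def)
  show ?thesis
  proof (rule that)
    show "(k / s)\<^sup>2 + (l / s)\<^sup>2 + (m / s)\<^sup>2 = 1"
      using *(1) by (simp add: power_divide s(1) flip: add_divide_distrib)
    have "(k / s) * p + (l / s) * q + (m / s) * d = (k * p + l * q + m * d) / s"
      by (simp add: add_divide_distrib)
    with * show "(k / s) * p + (l / s) * q + (m / s) * d = 0"
      by simp
  qed
qed

text \<open>Every point of the unit sphere is the Bloch vector of a unit vector \<open>(\<alpha>, \<beta>)\<close>: this is
  surjectivity of the Hopf map. Away from the south pole \<open>\<alpha>\<close> can be taken positive, and then
  \<open>2 \<alpha>\<^sup>2 = 1 + m\<close> determines both.\<close>

lemma bloch_vector:
  fixes k l m :: real
  assumes "k\<^sup>2 + l\<^sup>2 + m\<^sup>2 = 1"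
  obtains \<alpha> \<beta> :: complex where "\<alpha> * cnj \<alpha> + \<beta> * cnj \<beta> = 1" "\<alpha> * cnj \<alpha> - \<beta> * cnj \<beta> = m"
    "2 * \<alpha> * cnj \<beta> = Complex k l"
proof (cases "m = -1")
  case True
  with assms have "k = 0 \<and> l = 0"
    by (simp add: sum_power2_eq_zero_iff)
  with True show ?thesis
    by (intro that[of 0 1]) (auto simp: complex_eq_iff)
next
  case False
  have "m\<^sup>2 \<le> 1"
    using assms by (smt (verit) zero_le_power2)
  then have "-1 < m"
    using False by (simp add: abs_square_le_1)
  define a where "a = sqrt ((1 + m) / 2)"
  have a: "a > 0" "2 * a\<^sup>2 = 1 + m"
    using \<open>-1 < m\<close> by (auto simp: a_def)
  define \<beta> where "\<beta> = Complex (k / (2 * a)) (- l / (2 * a))"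
  have "\<beta> * cnj \<beta> = complex_of_real ((k\<^sup>2 + l\<^sup>2) / (4 * a\<^sup>2))"
    by (simp add: \<beta>_def complex_mult_cnj power_divide add_divide_distrib power_mult_distrib)
  also have "(k\<^sup>2 + l\<^sup>2) / (4 * a\<^sup>2) = (1 - m) / 2"
  proof -
    have "k\<^sup>2 + l\<^sup>2 = (1 - m) * (2 * a\<^sup>2)"
      using assms unfolding a by (simp add: algebra_simps power2_eq_square)
    then show ?thesis
      using a(1) by simp
  qed
  finally have b: "\<beta> * cnj \<beta> = complex_of_real ((1 - m) / 2)" .
  have "a * a = (1 + m) / 2"
    using a(2) by (simp add: power2_eq_square)
  then have aa: "complex_of_real a * cnj (complex_of_real a) = complex_of_real ((1 + m) / 2)"
    by (metis complex_cnj_complex_of_real of_real_mult)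
  show ?thesis
  proof (rule that)
    show "complex_of_real a * cnj (complex_of_real a) + \<beta> * cnj \<beta> = 1"
      unfolding aa b by (simp add: complex_eq_iff field_simps)
    show "complex_of_real a * cnj (complex_of_real a) - \<beta> * cnj \<beta> = m"
      unfolding aa b by (simp add: complex_eq_iff field_simps)
    show "2 * complex_of_real a * cnj \<beta> = Complex k l"
      using a by (simp add: \<beta>_def complex_eq_iff)
  qed
qed

text \<open>Under the rotation given by \<open>(\<alpha>, \<beta>)\<close> the difference of the two diagonal entries becomes a
  real-linear function of the Bloch vector of \<open>(\<alpha>, \<beta>)\<close>. It takes values in the plane, so it vanishes at
  some point of the sphere.\<close>

lemma equal_diagonal_pair:
  fixes T :: "'a::complex_inner \<Rightarrow> 'a"
  assumes T: "clinear T" and e: "orthonormal {e1, e2}" "e1 \<noteq> e2"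
  obtains f1 f2 where "orthonormal {f1, f2}" "f1 \<noteq> f2" "expansion {f1, f2} = expansion {e1, e2}"
    "cinner (T f1) f1 = cinner (T f2) f2"
proof -
  define b c d where "b = cinner (T e1) e2" and "c = cinner (T e2) e1"
    and "d = cinner (T e1) e1 - cinner (T e2) e2"
  obtain k l m :: real where n: "k\<^sup>2 + l\<^sup>2 + m\<^sup>2 = 1" "k * (b + c) + l * (\<i> * (b - c)) + m * d = 0"
    by (rule real_unit_relation)
  obtain \<alpha> \<beta> :: complex where ab: "\<alpha> * cnj \<alpha> + \<beta> * cnj \<beta> = 1" "\<alpha> * cnj \<alpha> - \<beta> * cnj \<beta> = m"
    "2 * \<alpha> * cnj \<beta> = Complex k l"
    using bloch_vector[OF n(1)] .
  from ab(3) have ab3': "2 * cnj \<alpha> * \<beta> = Complex k (- l)"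
    by (metis complex_cnj complex_cnj_cnj complex_cnj_mult complex_cnj_numeral)
  let ?f1 = "\<alpha> *\<^sub>C e1 + \<beta> *\<^sub>C e2" and ?f2 = "cnj \<alpha> *\<^sub>C e2 - cnj \<beta> *\<^sub>C e1"
  have "cinner (T ?f1) ?f1 - cinner (T ?f2) ?f2
      = (2 * \<alpha> * cnj \<beta>) * b + (2 * cnj \<alpha> * \<beta>) * c + (\<alpha> * cnj \<alpha> - \<beta> * cnj \<beta>) * d"
    by (simp add: clinear_simps[OF T] cinner_simps b_def c_def d_def algebra_simps)
  also have "\<dots> = k * (b + c) + l * (\<i> * (b - c)) + m * d"
    unfolding ab ab3' by (simp add: complex_eq_iff algebra_simps)
  finally have "cinner (T ?f1) ?f1 = cinner (T ?f2) ?f2"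
    using n by simp
  with rotate_orthonormal_pair[OF e ab(1)] show ?thesis
    by (rule that)
qed

text \<open>Passing from \<open>f\<^sub>1, f\<^sub>2\<close> to \<open>(f\<^sub>1 + \<i> f\<^sub>2) / \<surd>2, (f\<^sub>2 + \<i> f\<^sub>1) / \<surd>2\<close> turns the difference of the
  diagonal entries, up to a factor, into the difference of the off-diagonal ones.\<close>

lemma symmetric_matrix_pair:
  fixes T :: "'a::complex_inner \<Rightarrow> 'a"
  assumes T: "clinear T" and e: "orthonormal {e1, e2}" "e1 \<noteq> e2"
  obtains u1 u2 where "orthonormal {u1, u2}" "expansion {u1, u2} = expansion {e1, e2}"
    "cinner (T u1) u2 = cinner (T u2) u1"
proof -
  obtain f1 f2 where f: "orthonormal {f1, f2}" "f1 \<noteq> f2" "expansion {f1, f2} = expansion {e1, e2}"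
    and diag: "cinner (T f1) f1 = cinner (T f2) f2"
    using equal_diagonal_pair[OF T e] .
  define r where "r = complex_of_real (1 / sqrt 2)"
  have r: "cnj r = r" "r * r = 1 / 2"
    by (auto simp: r_def simp flip: of_real_mult)
  have "r * cnj r + (\<i> * r) * cnj (\<i> * r) = 2 * (r * r)"
    by (simp add: r(1) algebra_simps)
  then have "r * cnj r + (\<i> * r) * cnj (\<i> * r) = 1"
    by (simp add: r(2))
  note u = rotate_orthonormal_pair[OF f(1,2) this]
  show ?thesis
    by (rule that[OF u(1) trans[OF u(3) f(3)]])
      (simp add: clinear_simps[OF T] cinner_simps diag r algebra_simps)
qed

text \<open>Equality of the expansions says that the two orthonormal sets span the same subspace.\<close>

lemma symmetric_matrix_of_card_le_2:
  fixes T :: "'a::complex_inner \<Rightarrow> 'a"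
  assumes T: "clinear T" and E: "finite E" "orthonormal E" "card E \<le> 2"
  obtains E' where "orthonormal E'" "expansion E' = expansion E"
    "\<And>u v. u \<in> E' \<Longrightarrow> v \<in> E' \<Longrightarrow> cinner (T u) v = cinner (T v) u"
proof (cases "card E = 2")
  case True
  then obtain e1 e2 where e: "E = {e1, e2}" "e1 \<noteq> e2"
    by (auto simp: card_2_iff)
  obtain u1 u2 where u: "orthonormal {u1, u2}" "expansion {u1, u2} = expansion {e1, e2}"
    "cinner (T u1) u2 = cinner (T u2) u1"
    using symmetric_matrix_pair[OF T _ e(2)] E(2) unfolding e(1) .
  show ?thesis
    by (rule that[of "{u1, u2}"]) (use u e in auto)
next
  case False
  with E have "card E \<le> 1"
    by simp
  then have "u = v" if "u \<in> E" "v \<in> E" for u v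
    using that E(1) card_le_Suc0_iff_eq[of E] by simp
  then show ?thesis
    using E by (intro that[of E]) auto
qed

section \<open>Unitary operators and eigenbases\<close>

text \<open>The vector \<open>p(U) v\<close>, evaluated by Horner's scheme.\<close>

definition poly_orbit :: "('a::complex_inner \<Rightarrow> 'a) \<Rightarrow> 'a \<Rightarrow> complex poly \<Rightarrow> 'a" where
  "poly_orbit U v p = fold_coeffs (\<lambda>a w. a *\<^sub>C v + U w) p 0"

context
  fixes U :: "'a::complex_inner \<Rightarrow> 'a" and v :: 'a
  assumes U: "clinear U"
begin

lemma poly_orbit_0: "poly_orbit U v 0 = 0"
  by (simp add: poly_orbit_def)

lemma poly_orbit_pCons: "poly_orbit U v (pCons a p) = a *\<^sub>C v + U (poly_orbit U v p)"
  by (simp add: poly_orbit_def fold_coeffs_def cCons_def clinear_zero[OF U])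

lemma poly_orbit_add: "poly_orbit U v (p + q) = poly_orbit U v p + poly_orbit U v q"
  by (induction p q rule: poly_induct2)
    (simp_all add: poly_orbit_0 poly_orbit_pCons clinear_simps[OF U] scaleC_add_left)

lemma poly_orbit_smult: "poly_orbit U v (smult c p) = c *\<^sub>C poly_orbit U v p"
  by (induction p)
    (simp_all add: poly_orbit_0 poly_orbit_pCons clinear_simps[OF U] scaleC_add_right)

lemma poly_orbit_monom: "poly_orbit U v (monom c n) = c *\<^sub>C (U ^^ n) v"
  by (induction n) (simp_all add: monom_0 monom_Suc poly_orbit_pCons poly_orbit_0 clinear_simps[OF U])

lemma poly_orbit_sum: "poly_orbit U v (\<Sum>i\<in>I. p i) = (\<Sum>i\<in>I. poly_orbit U v (p i))"
  by (induction I rule: infinite_finite_induct) (auto simp: poly_orbit_0 poly_orbit_add)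

lemma poly_orbit_linear_factor:
  "poly_orbit U v ([:- a, 1:] * q) = U (poly_orbit U v q) - a *\<^sub>C poly_orbit U v q"
proof -
  have *: "[:- a, 1:] * q = pCons 0 q + smult (- a) q"
    by simp
  show ?thesis
    unfolding * poly_orbit_add poly_orbit_smult poly_orbit_pCons by simp
qed

lemma poly_orbit_mem:
  assumes "complex_vector.subspace S" "\<And>x. x \<in> S \<Longrightarrow> U x \<in> S" "v \<in> S"
  shows "poly_orbit U v p \<in> S"
  by (induction p) (use assms in \<open>auto simp: poly_orbit_0 poly_orbit_pCons complex_vector.subspace_def\<close>)

text \<open>More iterates of \<open>v\<close> than the dimension allows are linearly dependent. A coincidence between two
  iterates is treated apart, since dependence is a property of the set of iterates.\<close>

lemma annihilating_poly:
  assumes B: "finite B" "complex_vector.span B = (UNIV :: 'a set)"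
  obtains p where "p \<noteq> 0" "poly_orbit U v p = 0"
proof (cases "inj_on (\<lambda>i. (U ^^ i) v) {..card B}")
  case True
  let ?f = "\<lambda>i. (U ^^ i) v" and ?n = "card B"
  have "complex_vector.dependent (?f ` {..?n})"
  proof (rule ccontr)
    assume "complex_vector.independent (?f ` {..?n})"
    then have "card (?f ` {..?n}) \<le> card B"
      using complex_vector.independent_span_bound[OF B(1), of "?f ` {..?n}"] B(2) by simp
    then show False
      using card_image[OF True] by simp
  qed
  then obtain u i where u: "(\<Sum>w\<in>?f ` {..?n}. u w *\<^sub>C w) = 0" "i \<le> ?n" "u (?f i) \<noteq> 0"
    by (auto simp: complex_vector.dependent_finite)
  define p where "p = (\<Sum>i\<le>?n. monom (u (?f i)) i)"
  have "coeff p i = u (?f i)"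
    using u(2) by (simp add: p_def coeff_sum)
  then have "p \<noteq> 0"
    using u(3) by auto
  moreover have "poly_orbit U v p = 0"
    using u(1) by (simp add: p_def poly_orbit_sum poly_orbit_monom sum.reindex[OF True])
  ultimately show ?thesis
    by (rule that)
next
  case False
  then obtain i j where ij: "i \<noteq> j" "(U ^^ i) v = (U ^^ j) v"
    by (auto simp: inj_on_def)
  define p where "p = monom 1 i + monom (- 1 :: complex) j"
  have "coeff p i = 1"
    using ij(1) by (simp add: p_def)
  then have "p \<noteq> 0"
    by auto
  moreover have "poly_orbit U v p = 0"
    by (simp add: p_def poly_orbit_add poly_orbit_monom ij(2))
  ultimately show ?thesis
    by (rule that)
qed

text \<open>For \<open>p\<close> of least degree with \<open>p(U) v = 0\<close>, split off a root \<open>a\<close>, say \<open>p = (X - a) q\<close>.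
  Minimality makes \<open>q(U) v\<close> nonzero, hence an eigenvector for \<open>a\<close>.\<close>

lemma eigenvector_in_invariant_subspace:
  assumes B: "finite B" "complex_vector.span B = (UNIV :: 'a set)"
    and S: "complex_vector.subspace S" "\<And>x. x \<in> S \<Longrightarrow> U x \<in> S" "v \<in> S" "v \<noteq> 0"
  obtains w a where "w \<in> S" "w \<noteq> 0" "U w = a *\<^sub>C w"
proof -
  let ?P = "\<lambda>p. p \<noteq> 0 \<and> poly_orbit U v p = 0"
  obtain p0 where "?P p0"
    using annihilating_poly[OF B] by blast
  then obtain p where p: "?P p" and min: "\<And>q. ?P q \<Longrightarrow> degree p \<le> degree q"
    using arg_min_natI[of ?P p0 degree] arg_min_nat_le[of ?P _ degree] by blast
  have "degree p \<noteq> 0"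
  proof
    assume "degree p = 0"
    then obtain c where "p = [:c:]"
      by (rule degree_eq_zeroE)
    with p S(4) show False
      by (auto simp: poly_orbit_pCons poly_orbit_0 clinear_zero[OF U])
  qed
  then obtain a where "poly p a = 0"
    using fundamental_theorem_of_algebra[of p] by (auto simp: constant_degree)
  then obtain q where q: "p = [:- a, 1:] * q"
    by (auto simp: poly_eq_0_iff_dvd elim: dvdE)
  have "q \<noteq> 0"
    using p q by auto
  then have "degree q < degree p"
    unfolding q by (subst degree_mult_eq) auto
  with min[of q] \<open>q \<noteq> 0\<close> have "poly_orbit U v q \<noteq> 0"
    by auto
  moreover have "U (poly_orbit U v q) = a *\<^sub>C poly_orbit U v q"
    using p unfolding q poly_orbit_linear_factor by simp
  ultimately show ?thesis
    using poly_orbit_mem[OF S(1-3)] by (intro that)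
qed

end

text \<open>The orthogonal complement of a set of eigenvectors of a unitary operator is invariant; if it were
  nonzero it would contain a further eigenvector, so a maximal orthonormal set of eigenvectors is a
  basis. Multiplying an eigenvector by a phase makes its inner product with a prescribed vector \<open>k\<close>
  real, so this condition can be built into the maximal set.\<close>

lemma unitary_eigenbasis:
  fixes U :: "'a::complex_inner \<Rightarrow> 'a"
  assumes B: "finite B" "complex_vector.span B = (UNIV :: 'a set)"
    and U: "clinear U" and iso: "\<And>x y. cinner (U x) (U y) = cinner x y"
  obtains G where "orthonormal_basis G" "\<And>g. g \<in> G \<Longrightarrow> \<exists>a. U g = a *\<^sub>C g"
    "\<And>g. g \<in> G \<Longrightarrow> cinner k g \<in> \<real>"
proof -
  let ?Q = "{x. (\<exists>a. U x = a *\<^sub>C x) \<and> cinner k x \<in> \<real>}"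
  obtain G where G: "finite G" "orthonormal G" "G \<subseteq> ?Q"
    and max: "\<And>x. x \<in> ?Q \<Longrightarrow> norm x = 1 \<Longrightarrow> \<exists>e\<in>G. cinner x e \<noteq> 0"
    by (rule maximal_orthonormal[OF B, of "{}" ?Q]) (auto simp: orthonormal_def)
  let ?S = "{x. \<forall>g\<in>G. cinner x g = 0}"
  have S: "complex_vector.subspace ?S"
    by (auto simp: complex_vector.subspace_def cinner_simps)
  have inv: "U x \<in> ?S" if "x \<in> ?S" for x
  proof safe
    fix g assume "g \<in> G"
    then obtain a where a: "U g = a *\<^sub>C g"
      using G(3) by blast
    have "cnj a * cinner (U g) g = cinner (U g) (U g)"
      by (simp add: a cinner_simps)
    also have "\<dots> = 1"
      using \<open>g \<in> G\<close> G(2) by (simp add: iso orthonormal_def)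
    finally have "a \<noteq> 0"
      by auto
    have "cnj a * cinner (U x) g = cinner (U x) (U g)"
      by (simp add: a cinner_simps)
    also have "\<dots> = 0"
      using that \<open>g \<in> G\<close> by (simp add: iso)
    finally show "cinner (U x) g = 0"
      using \<open>a \<noteq> 0\<close> by simp
  qed
  have "expansion G x = x" for x
  proof (rule ccontr)
    assume ne: "expansion G x \<noteq> x"
    have "x - expansion G x \<in> ?S"
      using cinner_expansion_orthonormal[OF G(2,1)] by (simp add: cinner_diff_left)
    moreover have "x - expansion G x \<noteq> 0"
      using ne by simp
    ultimately obtain w a where w: "w \<in> ?S" "w \<noteq> 0" "U w = a *\<^sub>C w"
      using eigenvector_in_invariant_subspace[OF U B S, of "x - expansion G x"] inv by blast
    define c where "c = (if cinner k w = 0 then 1 else sgn (cinner k w))"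
    have c: "norm c = 1" "cnj c * cinner k w \<in> \<real>"
      by (auto simp: c_def norm_sgn)
        (simp add: sgn_eq mult.commute[of "cnj _"] flip: complex_norm_square)
    define y where "y = (c / norm w) *\<^sub>C w"
    have "cinner y y = 1"
    proof -
      have "cinner y y = (c * cnj c) * (cinner w w / (norm w)\<^sup>2)"
        by (simp add: y_def cinner_simps power2_eq_square)
      then show ?thesis
        using c(1) w(2) by (simp add: cinner_self complex_mult_cnj flip: cmod_power2)
    qed
    then have "norm y = 1"
      by (simp add: norm_eq_sqrt_cinner)
    moreover have "U y = a *\<^sub>C y"
      by (simp add: y_def clinear_simps[OF U] w(3) mult.commute)
    moreover have "cinner k y \<in> \<real>"
      using c(2) by (simp add: y_def cinner_simps)
    moreover have "cinner y e = 0" if "e \<in> G" for e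
      using w(1) that by (simp add: y_def cinner_simps)
    ultimately show False
      using max by blast
  qed
  with G show ?thesis
    by (intro that[of G]) (auto simp: orthonormal_basis_def)
qed

text \<open>Let \<open>V\<close> be the real subspace of vectors with real coefficients in an eigenbasis of \<open>U\<close>. Diagonal
  matrices are symmetric, so \<open>\<langle>U x, y\<rangle> = \<langle>U y, x\<rangle>\<close> for \<open>x, y\<close> in \<open>V\<close>, and any orthonormal basis of \<open>V\<close>
  will do. The eigenbasis is chosen so that \<open>k\<close> belongs to \<open>V\<close>; this is what limits \<open>E0\<close> to at
  most one vector, since its phases can be adjusted to a single vector only.\<close>

lemma unitary_symmetric_matrix:
  fixes U :: "'a::complex_inner \<Rightarrow> 'a"
  assumes B: "finite B" "complex_vector.span B = (UNIV :: 'a set)"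
    and U: "clinear U" and iso: "\<And>x y. cinner (U x) (U y) = cinner x y"
    and E0: "orthonormal E0" "E0 \<subseteq> {k}"
  obtains E where "orthonormal_basis E" "E0 \<subseteq> E"
    "\<And>u v. u \<in> E \<Longrightarrow> v \<in> E \<Longrightarrow> cinner (U u) v = cinner (U v) u"
proof -
  obtain G where G: "orthonormal_basis G" and eig: "\<And>g. g \<in> G \<Longrightarrow> \<exists>a. U g = a *\<^sub>C g"
    and k: "\<And>g. g \<in> G \<Longrightarrow> cinner k g \<in> \<real>"
    using unitary_eigenbasis[OF B U iso] by blast
  let ?V = "{x. \<forall>g\<in>G. cinner x g \<in> \<real>}"
  have flip: "cinner g x = cinner x g" if "x \<in> ?V" "g \<in> G" for x g
    using that cinner_real_commute by blast
  have sub: "subspace ?V"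
    by (auto simp: subspace_def cinner_simps scaleR_scaleC)
  have real: "cinner x y \<in> \<real>" if "x \<in> ?V" "y \<in> ?V" for x y
    unfolding parseval[OF G, of x y]
  proof (rule sum_in_Reals)
    fix g assume g: "g \<in> G"
    then show "cinner x g * cinner g y \<in> \<real>"
      unfolding flip[OF that(2) g] using that by (intro Reals_mult) auto
  qed
  obtain E where E: "finite E" "orthonormal E" "E0 \<subseteq> E" "E \<subseteq> ?V"
    and exp: "\<And>x. x \<in> ?V \<Longrightarrow> expansion E x = x"
  proof (rule orthonormal_extend[OF B sub _ E0(1)])
    show "cinner x y *\<^sub>C y \<in> ?V" if xy: "x \<in> ?V" "y \<in> ?V" for x y
      using real[OF xy] xy(2) by (auto simp: cinner_scaleC_left intro: Reals_mult)
    show "E0 \<subseteq> ?V"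
      using E0(2) k by auto
  qed blast
  have GV: "g \<in> ?V" if "g \<in> G" for g
    using G that by (auto simp: orthonormal_basis_def orthonormal_def)
  have "expansion E x = x" for x
  proof -
    have "expansion E (expansion G x) = (\<Sum>g\<in>G. cinner x g *\<^sub>C expansion E g)"
      unfolding expansion_def[of G] expansion_def[of E]
      by (simp add: cinner_simps complex_vector.scale_sum_left complex_vector.scale_sum_right sum.swap[of _ E])
    also have "\<dots> = expansion G x"
      unfolding expansion_def[of G] by (rule sum.cong) (simp_all only: exp[OF GV])
    finally show ?thesis
      using G by (simp add: orthonormal_basis_def)
  qed
  moreover have "cinner (U u) v = cinner (U v) u" if "u \<in> E" "v \<in> E" for u v
  proof -
    have form: "cinner (U x) y = (\<Sum>g\<in>G. cinner x g * cinner y g * cinner (U g) g)"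
      if "x \<in> ?V" "y \<in> ?V" for x y
    proof -
      have "cinner (U x) y = cinner (U (expansion G x)) y"
        using G by (simp add: orthonormal_basis_def)
      also have "\<dots> = (\<Sum>g\<in>G. cinner x g * cinner (U g) y)"
        by (simp add: expansion_def clinear_simps[OF U] cinner_simps)
      also have "\<dots> = (\<Sum>g\<in>G. cinner x g * cinner y g * cinner (U g) g)"
      proof (rule sum.cong)
        fix g assume g: "g \<in> G"
        then obtain a where a: "U g = a *\<^sub>C g"
          using eig by blast
        moreover have "cinner g g = 1"
          using G g by (simp add: orthonormal_basis_def orthonormal_def)
        ultimately show "cinner x g * cinner (U g) y = cinner x g * cinner y g * cinner (U g) g"
          using flip[OF that(2) g] by (simp add: cinner_simps)
      qed simp
      finally show ?thesis .
    qed
    show ?thesis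
      using that E(4) by (subst (1 2) form) (auto simp: mult_ac)
  qed
  ultimately show ?thesis
    using E by (intro that[of E]) (auto simp: orthonormal_basis_def)
qed

section \<open>Partial isometries\<close>

text \<open>Polarization: equal norms at \<open>x + y\<close> and \<open>x + \<i> y\<close> determine the inner product.\<close>

lemma isometric_on_subspace_cinner:
  fixes T :: "'a::complex_inner \<Rightarrow> 'a"
  assumes T: "clinear T" and M: "complex_vector.subspace M"
    and norm: "\<And>x. x \<in> M \<Longrightarrow> norm (T x) = norm x" and xy: "x \<in> M" "y \<in> M"
  shows "cinner (T x) (T y) = cinner x y"
proof -
  have self: "cinner (T x) (T x) = cinner x x" if "x \<in> M" for x
    using norm[OF that] by (simp add: cinner_self)
  have "x + y \<in> M" "x + \<i> *\<^sub>C y \<in> M"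
    using M xy by (auto simp: complex_vector.subspace_def)
  from self[OF this(1)] self[OF this(2)]
  have 1: "cinner (T x) (T y) + cinner (T y) (T x) = cinner x y + cinner y x"
    and "\<i> * (cinner (T y) (T x) - cinner (T x) (T y)) = \<i> * (cinner y x - cinner x y)"
    using self[OF xy(1)] self[OF xy(2)]
    by (simp_all add: clinear_simps[OF T] cinner_simps algebra_simps)
  then have 2: "cinner (T y) (T x) - cinner (T x) (T y) = cinner y x - cinner x y"
    by simp
  have "2 * cinner (T x) (T y) = 2 * cinner x y"
    using 1 2 by algebra
  then show ?thesis
    by simp
qed

text \<open>The images of \<open>D\<close> are orthonormal and extend to a basis \<open>F\<close>; the complements of \<open>D\<close> in \<open>E\<close> and
  of its image in \<open>F\<close> have the same size, so any bijection between them completes the map.\<close>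

lemma unitary_extension:
  fixes T :: "'a::complex_inner \<Rightarrow> 'a"
  assumes B: "finite B" "complex_vector.span B = (UNIV :: 'a set)"
    and E: "orthonormal_basis E" "D \<subseteq> E"
    and iso: "\<And>u v. u \<in> D \<Longrightarrow> v \<in> D \<Longrightarrow> cinner (T u) (T v) = cinner u v"
  obtains U where "clinear U" "\<And>x y. cinner (U x) (U y) = cinner x y" "\<And>u. u \<in> D \<Longrightarrow> U u = T u"
proof -
  have E': "finite E" "orthonormal E" "\<And>x. expansion E x = x"
    using E by (auto simp: orthonormal_basis_def)
  have finD: "finite D" and onD: "orthonormal D"
    using E E' finite_subset orthonormal_subset by blast+
  have inj: "inj_on T D"
  proof
    fix u v assume uv: "u \<in> D" "v \<in> D" "T u = T v"
    then have "cinner u v = cinner u u"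
      using iso by metis
    then show "u = v"
      using onD uv by (auto simp: orthonormal_def split: if_splits)
  qed
  have "orthonormal (T ` D)"
    using onD inj by (auto simp: orthonormal_def iso inj_on_eq_iff)
  then obtain F where F: "orthonormal_basis F" "T ` D \<subseteq> F"
    using orthonormal_basis_extend[OF B] by blast
  have F': "finite F" "orthonormal F"
    using F by (auto simp: orthonormal_basis_def)
  have "card (E - D) = card (F - T ` D)"
    using orthonormal_basis_card_eq[OF E(1) F(1)] E(2) F(2) finD
    by (simp add: card_Diff_subset card_image[OF inj])
  then obtain \<phi> where \<phi>: "bij_betw \<phi> (E - D) (F - T ` D)"
    using finite_same_card_bij E' F' by (metis finite_Diff)
  define \<psi> where "\<psi> e = (if e \<in> D then T e else \<phi> e)" for e
  have "bij_betw \<psi> (D \<union> (E - D)) (T ` D \<union> (F - T ` D))"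
  proof (rule bij_betw_combine)
    show "bij_betw \<psi> D (T ` D)"
      using inj by (simp add: \<psi>_def bij_betw_def inj_on_def)
    show "bij_betw \<psi> (E - D) (F - T ` D)"
      using \<phi> by (rule bij_betw_cong[THEN iffD1, rotated]) (simp add: \<psi>_def)
  qed auto
  then have \<psi>: "bij_betw \<psi> E F"
    using E(2) F(2) by (simp add: Un_absorb1 Un_Diff_cancel)
  have \<psi>_on: "cinner (\<psi> e) (\<psi> f) = cinner e f" if "e \<in> E" "f \<in> E" for e f
    using that \<psi> E'(2) F'(2) by (auto simp: bij_betw_def orthonormal_def inj_on_eq_iff)
  define U where "U x = (\<Sum>e\<in>E. cinner x e *\<^sub>C \<psi> e)" for x
  show ?thesis
  proof (rule that)
    show "clinear U"
      by (rule clinearI) (simp_all add: U_def cinner_simps scaleC_add_left sum.distrib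
          complex_vector.scale_sum_right)
    show "cinner (U x) (U y) = cinner x y" for x y
    proof -
      have "cinner (U x) (U y) = cinner (expansion E x) (expansion E y)"
        by (simp add: U_def expansion_def cinner_simps \<psi>_on cong: sum.cong)
      then show ?thesis
        by (simp add: E')
    qed
    show "U u = T u" if "u \<in> D" for u
    proof -
      have "U u = (\<Sum>e\<in>E. if e = u then \<psi> e else 0)"
        unfolding U_def using that E E'(2) by (intro sum.cong) (auto simp: orthonormal_def)
      then show ?thesis
        using that E E'(1) by (auto simp: \<psi>_def)
    qed
  qed
qed

section \<open>Partial isometries in dimension at most four\<close>

theorem corollary2:
  fixes T :: "'a::chilbert_space \<Rightarrow> 'a"
  assumes "\<exists>B :: 'a set. complex_vector.independent B \<and> complex_vector.span B = UNIV \<and>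
             finite B \<and> card B \<le> 4"
    and "bounded_clinear T"
    and "partial_isometry T"
  shows "complex_symmetric T"
proof -
  obtain B :: "'a set" where B: "finite B" "complex_vector.span B = UNIV" and card: "card B \<le> 4"
    using assms(1) by blast
  have T: "clinear T"
    using assms(2) by (intro clinearI) (auto simp: bounded_clinear_def linear_simps)
  let ?K = "{y. T y = 0}"
  let ?M = "corthogonal_comp ?K"
  have K: "complex_vector.subspace ?K"
    by (auto simp: complex_vector.subspace_def clinear_simps[OF T])
  have M: "complex_vector.subspace ?M"
    by (auto simp: complex_vector.subspace_def corthogonal_comp_def cinner_simps)
  have iso: "cinner (T x) (T y) = cinner x y" if "x \<in> ?M" "y \<in> ?M" for x y
    using isometric_on_subspace_cinner[OF T M _ that] assms(3) by (simp add: partial_isometry_def)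
  obtain E0 where E0: "finite E0" "orthonormal E0" "E0 \<subseteq> ?K" "\<And>x. x \<in> ?K \<Longrightarrow> expansion E0 x = x"
    by (rule orthonormal_extend[OF B complex_subspace_imp_subspace[OF K], of "{}"])
      (use K in \<open>auto simp: orthonormal_def clinear_simps[OF T]\<close>)
  \<comment> \<open>For every orthonormal basis \<open>E\<close> through \<open>E0\<close>, the rest \<open>E - E0\<close> is an orthonormal basis of \<open>?M\<close>;
    the case \<open>dim ?K \<le> 1\<close> uses this for a second basis \<open>E'\<close>.\<close>
  have T_expansion: "T (expansion (E - E0) x) = T x" if E: "orthonormal_basis E" "E0 \<subseteq> E" for E x
  proof -
    have "T x = T (expansion E x)"
      using E by (simp add: orthonormal_basis_def)
    also have "expansion E x = expansion (E - E0) x + expansion E0 x"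
      using E by (intro expansion_split) (simp_all add: orthonormal_basis_def)
    also have "T \<dots> = T (expansion (E - E0) x) + (\<Sum>e\<in>E0. cinner x e *\<^sub>C T e)"
      by (simp add: clinear_simps[OF T] expansion_def[of E0])
    also have "(\<Sum>e\<in>E0. cinner x e *\<^sub>C T e) = 0"
      using E0(3) by (intro sum.neutral) auto
    finally show ?thesis
      by simp
  qed
  have in_M: "E - E0 \<subseteq> ?M" if E: "orthonormal_basis E" "E0 \<subseteq> E" for E
  proof -
    have "cinner e y = 0" if "e \<in> E - E0" "y \<in> ?K" for e y
    proof -
      have "cinner e y = cinner e (expansion E0 y)"
        using E0(4)[OF that(2)] by simp
      also have "\<dots> = 0"
        unfolding cinner_expansion_right using that(1) E
        by (intro sum.neutral) (auto simp: orthonormal_basis_def orthonormal_def)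
      finally show ?thesis .
    qed
    then show ?thesis
      by (auto simp: corthogonal_comp_def)
  qed
  obtain E where E: "orthonormal_basis E" "E0 \<subseteq> E"
    using orthonormal_basis_extend[OF B E0(2)] by blast
  let ?D = "E - E0"
  have D: "finite ?D" "orthonormal ?D"
    using E orthonormal_subset[of E ?D] by (auto simp: orthonormal_basis_def)
  have "card ?D + card E0 \<le> 4"
    using orthonormal_card_le[OF _ B, of E] E E0(1) card card_mono[of E E0]
    by (auto simp: orthonormal_basis_def card_Diff_subset)
  then consider "card ?D \<le> 2" | "card E0 \<le> 1"
    by linarith
  then show ?thesis
  proof cases
    case 1
    obtain E' where E': "orthonormal E'" "expansion E' = expansion ?D"
      and sym: "\<And>u v. u \<in> E' \<Longrightarrow> v \<in> E' \<Longrightarrow> cinner (T u) v = cinner (T v) u"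
      using symmetric_matrix_of_card_le_2[OF T D 1] by blast
    have "finite E'"
      using orthonormal_card_le[OF E'(1) B] by blast
    have "E' \<subseteq> ?M"
    proof
      fix u assume u: "u \<in> E'"
      have "u = expansion E' u"
        unfolding expansion_def using E'(1) u \<open>finite E'\<close>
        by (subst sum.cong[OF refl, where h = "\<lambda>e. if e = u then u else 0"]) (auto simp: orthonormal_def)
      also have "\<dots> = expansion ?D u"
        by (simp add: E'(2))
      also have "\<dots> \<in> ?M"
        unfolding expansion_def using in_M[OF E] M
        by (intro complex_vector.subspace_sum complex_vector.subspace_scale) auto
      finally show "u \<in> ?M" .
    qed
    then have "cinner (T u) (T v) = cinner u v" if "u \<in> E'" "v \<in> E'" for u v
      using iso that by blast
    moreover have "T (expansion E' x) = T x" for x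
      using T_expansion[OF E] by (simp add: E'(2))
    ultimately show ?thesis
      using complex_symmetric_of_symmetric_matrix[OF B T E'(1) _ _ sym] by blast
  next
    case 2
    then have "\<forall>a\<in>E0. \<forall>b\<in>E0. a = b"
      using card_le_Suc0_iff_eq[OF E0(1)] by simp
    then obtain k where k: "E0 \<subseteq> {k}"
      by blast
    obtain U where U: "clinear U" "\<And>x y. cinner (U x) (U y) = cinner x y"
      and UT: "\<And>u. u \<in> ?D \<Longrightarrow> U u = T u"
    proof (rule unitary_extension[OF B E(1)])
      show "?D \<subseteq> E"
        by blast
      show "cinner (T u) (T v) = cinner u v" if "u \<in> ?D" "v \<in> ?D" for u v
        using that in_M[OF E] by (intro iso) blast+
    qed blast
    have UM: "U x = T x" if "x \<in> ?M" for x
    proof -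
      have "expansion E0 x = 0"
        unfolding expansion_def using that E0(3)
        by (intro sum.neutral) (auto simp: corthogonal_comp_def)
      moreover have "expansion E x = expansion ?D x + expansion E0 x"
        using E by (intro expansion_split) (simp_all add: orthonormal_basis_def)
      moreover have "expansion E x = x"
        using E by (simp add: orthonormal_basis_def)
      ultimately have x: "expansion ?D x = x"
        by simp
      have "U (expansion ?D x) = T (expansion ?D x)"
        unfolding expansion_def clinear_sum[OF T] clinear_sum[OF U(1)]
        by (rule sum.cong) (simp_all add: clinear_scaleC[OF T] clinear_scaleC[OF U(1)] UT)
      then show ?thesis
        by (simp only: x)
    qed
    obtain E' where E': "orthonormal_basis E'" "E0 \<subseteq> E'"
      and sym: "\<And>u v. u \<in> E' \<Longrightarrow> v \<in> E' \<Longrightarrow> cinner (U u) v = cinner (U v) u"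
      using unitary_symmetric_matrix[OF B U E0(2) k] by blast
    show ?thesis
    proof (rule complex_symmetric_of_symmetric_matrix[OF B T])
      show "orthonormal (E' - E0)"
        using E'(1) orthonormal_subset[of E'] by (auto simp: orthonormal_basis_def)
      show "T (expansion (E' - E0) x) = T x" for x
        by (rule T_expansion[OF E'])
      fix u v assume uv: "u \<in> E' - E0" "v \<in> E' - E0"
      then have uvM: "u \<in> ?M" "v \<in> ?M"
        using in_M[OF E'] by blast+
      show "cinner (T u) (T v) = cinner u v"
        by (rule iso[OF uvM])
      show "cinner (T u) v = cinner (T v) u"
        using sym[of u v] uv UM uvM by simp
    qed
  qed
qed

end
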